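(* Let $d\ge 1$, let $\{U_i^k\}_{i=1}^{d+1}$ be the unfolded TT-cores of the approximate accumulation $\hat{\mathcal X}^k$ (with $U_1^k,\dots,U_d^k$ having orthonormal columns), let $\mathcal Y^{k+1}\in\mathbb R^{n_1\times\cdots\times n_d\times n_{d+1}^{k+1}}$ be a new streamed tensor, and let $\epsilon_1,\dots,\epsilon_d\ge 0$ be the SVD truncation tolerances. Let $\{U_i^{k+1}\}_{i=1}^{d+1}$ be the output of the TT-ICE algorithm on this input, and let $\hat{\mathcal Y}^{k+1}$ be the TT-approximation of $\mathcal Y^{k+1}$ obtained by contracting the updated cores $\mathcal G_1^{k+1},\dots,\mathcal G_d^{k+1}$ with the last $n_{d+1}^{k+1}$ columns of $U_{d+1}^{k+1}$. Then $$\|\mathcal Y^{k+1}-\hat{\mathcal Y}^{k+1}\|_F\le\sqrt{\sum_{i=1}^{d}\epsilon_i^2}.$$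
   Context: Notation. $\|\cdot\|_F$ is the Frobenius norm (square root of the sum of squared entries) of a matrix or tensor. $\mathrm{reshape}(A,[m_1,\dots,m_p])$ rearranges the entries of $A$ into an array of size $m_1\times\cdots\times m_p$, using one fixed ordering convention for multi-indices (say column-major) everywhere. Tensor train (TT) format. The contraction of $\mathcal A\in\mathbb R^{n_1\times\cdots\times n_d}$ and $\mathcal B\in\mathbb R^{n_d\times\cdots\times n_D}$ sums over the last index of $\mathcal A$ and the first index of $\mathcal B$. A tensor is in TT-format with TT-cores $\mathcal G_i\in\mathbb R^{r_{i-1}\times n_i\times r_i}$ if it is the successive contraction of $\mathcal G_1,\mathcal G_2,\dots$ (last index of each with first index of the next), where the first and last TT-ranks equal 1. The unfolded core is $U_i=\mathrm{reshape}(\mathcal G_i,[r_{i-1}n_i,r_i])$, so $\mathcal G_i=\mathrm{reshape}(U_i,[r_{i-1},n_i,r_i])$. Stream and accumulation. At increment $\ell$ a tensor $\mathcal Y^\ell\in\mathbb R^{n_1\times\cdots\times n_d\times n_{d+1}^\ell}$ arrives ($n_{d+1}^\ell$ is the batch size). The accumulation $\mathcal X^k$ is the concatenation of $\mathcal Y^1,\dots,\mathcal Y^k$ along the last dimension, with last dimension $N_k=\sum_{\ell\le k}n_{d+1}^\ell$. Its approximation $\hat{\mathcal X}^k$ is given in TT-format by $d+1$ cores with TT-ranks $r_0^k=1,r_1^k,\dots,r_d^k,r_{d+1}^k=1$: unfolded cores $U_i^k\in\mathbb R^{r_{i-1}^kn_i\times r_i^k}$ with orthonormal columns for $i=1,\dots,d$,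 and a last core regarded as a matrix $U_{d+1}^k\in\mathbb R^{r_d^k\times N_k}$. Truncated SVD. For a matrix $R$ and $\epsilon\ge0$, $\mathrm{SVD}(R,\epsilon)$ computes the truncated singular value decomposition $R=U_RV_R+E$, where $U_R$ consists of the left singular vectors for the $r_R$ largest singular values, $V_R$ is the product of the corresponding diagonal singular value matrix and the right singular vectors (as rows), and $r_R$ is the smallest rank such that $\|E\|_F\le\epsilon$ (possibly $r_R=0$, in which case $U_R$ is empty). TT-ICE algorithm. Input: $\{U_i^k\}_{i=1}^{d+1}$, $\mathcal Y^{k+1}$, tolerances $\epsilon_1,\dots,\epsilon_d$. Set $r_0^{k+1}=1$, $Y_1=\mathrm{reshape}(\mathcal Y^{k+1},[n_1,n_2\cdots n_dn_{d+1}^{k+1}])$ and $U_1^{k,\mathrm{pad}}=U_1^k$. For $i=1,\dots,d$: 1. $R_i^k=(I-U_i^{k,\mathrm{pad}}(U_i^{k,\mathrm{pad}})^T)Y_i$. 2. Compute $\mathrm{SVD}(R_i^k,\epsilon_i)$, giving left singular vectors $U_{R_i}^k$ and rank $r_{R_i}$. 3. $U_i^{k+1}=[\,U_i^{k,\mathrm{pad}}\ \ U_{R_i}^k\,]$ and $r_i^{k+1}=r_i^k+r_{R_i}$. 4. Zero-pad the next core. If $i<d$: append $r_{R_i}$ zero rows below $\mathrm{reshape}(U_{i+1}^k,[r_i^k,n_{i+1}r_{i+1}^k])$ and reshape the result to size $[r_i^{k+1}n_{i+1},r_{i+1}^k]$; call it $U_{i+1}^{k,\mathrm{pad}}$. If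 $i=d$: $U_{d+1}^{k,\mathrm{pad}}$ is $U_{d+1}^k$ with $r_{R_d}$ zero rows appended below. 5. If $i<d$: $Y_{i+1}=\mathrm{reshape}((U_i^{k+1})^TY_i,[r_i^{k+1}n_{i+1},n_{i+2}\cdots n_dn_{d+1}^{k+1}])$. If $i=d$: $Y_{d+1}=(U_d^{k+1})^TY_d\in\mathbb R^{r_d^{k+1}\times n_{d+1}^{k+1}}$. Finally set $U_{d+1}^{k+1}=[\,U_{d+1}^{k,\mathrm{pad}}\ \ Y_{d+1}\,]$. Output: $\{U_i^{k+1}\}_{i=1}^{d+1}$, with cores $\mathcal G_i^{k+1}=\mathrm{reshape}(U_i^{k+1},[r_{i-1}^{k+1},n_i,r_i^{k+1}])$ for $i\le d$. *)

theory Defs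
  imports Complex_Main "Jordan_Normal_Form.Matrix"
begin

text \<open>
  Matrices are those of Jordan_Normal_Form, since the sizes are determined by ranks
  computed at run time. A tensor is a list of mode sizes and a function on multi-indices.
  Entries (of matrices and tensors) are counted from 0 and only the values at multi-indices
  within the mode sizes are meaningful; modes, cores and ranks are numbered from 1
  as in the usual notation, with \<open>r 0\<close> the leading rank.
\<close>

datatype tensor = Tensor (dims: "nat list") (entry: "nat list \<Rightarrow> real")

definition indices :: "nat list \<Rightarrow> nat list set" where
  "indices ds = {is. length is = length ds \<and> (\<forall>j<length ds. is ! j < ds ! j)}"

definition tensor_minus :: "tensor \<Rightarrow> tensor \<Rightarrow> tensor" where
  "tensor_minus A B = Tensor (dims A) (\<lambda>is. entry A is - entry B is)"

definition tensor_frob :: "tensor \<Rightarrow> real" where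
  "tensor_frob A = sqrt (\<Sum>is\<in>indices (dims A). (entry A is)\<^sup>2)"

definition mat_frob :: "real mat \<Rightarrow> real" where
  "mat_frob A = sqrt (\<Sum>i<dim_row A. \<Sum>j<dim_col A. (A $$ (i, j))\<^sup>2)"

definition tensor_of_mat :: "real mat \<Rightarrow> tensor" where
  "tensor_of_mat A = Tensor [dim_row A, dim_col A] (\<lambda>is. A $$ (is ! 0, is ! 1))"

text \<open>Column-major enumeration of multi-indices (first index fastest) and its inverse.\<close>

fun lin_index :: "nat list \<Rightarrow> nat list \<Rightarrow> nat" where
  "lin_index (d # ds) (i # is) = i + d * lin_index ds is"
| "lin_index _ _ = 0"

fun multi_index :: "nat list \<Rightarrow> nat \<Rightarrow> nat list" where
  "multi_index [] k = []"
| "multi_index (d # ds) k = (k mod d) # multi_index ds (k div d)"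

text \<open>Meaningful when the products of the old and of the new mode sizes agree.\<close>

definition reshape :: "tensor \<Rightarrow> nat list \<Rightarrow> tensor" where
  "reshape A ds = Tensor ds (\<lambda>is. entry A (multi_index (dims A) (lin_index ds is)))"

definition reshape_mat :: "tensor \<Rightarrow> nat \<Rightarrow> nat \<Rightarrow> real mat" where
  "reshape_mat A p q = mat p q (\<lambda>(i, j). entry (reshape A [p, q]) [i, j])"

definition contract :: "tensor \<Rightarrow> tensor \<Rightarrow> tensor" where
  "contract A B =
     (let a = length (dims A) - 1 in
      Tensor (butlast (dims A) @ tl (dims B))
        (\<lambda>is. \<Sum>k<last (dims A). entry A (take a is @ [k]) * entry B (k # drop a is)))"

definition first_cols :: "nat \<Rightarrow> real mat \<Rightarrow> real mat" where
  "first_cols q A = mat_of_cols (dim_row A) (take q (cols A))"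

definition last_cols :: "nat \<Rightarrow> real mat \<Rightarrow> real mat" where
  "last_cols q A = mat_of_cols (dim_row A) (drop (dim_col A - q) (cols A))"

definition append_cols :: "real mat \<Rightarrow> real mat \<Rightarrow> real mat" where
  "append_cols A B = mat_of_cols (dim_row A) (cols A @ cols B)"

definition append_zero_rows :: "nat \<Rightarrow> real mat \<Rightarrow> real mat" where
  "append_zero_rows q A = A @\<^sub>r 0\<^sub>m q (dim_col A)"

definition orthonormal_cols :: "real mat \<Rightarrow> bool" where
  "orthonormal_cols A \<longleftrightarrow> transpose_mat A * A = 1\<^sub>m (dim_col A)"

text \<open>
  Thin singular value decomposition. The vectors are not unique, so this and the
  notions built on it are relations; \<open>\<sigma> j\<close> is the singular value number \<open>j + 1\<close>.
\<close>

definition is_svd :: "real mat \<Rightarrow> real mat \<Rightarrow> (nat \<Rightarrow> real) \<Rightarrow> real mat \<Rightarrow> bool" where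
  "is_svd R U \<sigma> V \<longleftrightarrow>
     (let p = min (dim_row R) (dim_col R) in
      U \<in> carrier_mat (dim_row R) p \<and> orthonormal_cols U \<and>
      V \<in> carrier_mat (dim_col R) p \<and> orthonormal_cols V \<and>
      (\<forall>j<p. 0 \<le> \<sigma> j) \<and> (\<forall>i j. i \<le> j \<longrightarrow> j < p \<longrightarrow> \<sigma> j \<le> \<sigma> i) \<and>
      R = U * mat_diag p \<sigma> * transpose_mat V)"

text \<open>
  \<open>is_truncated_svd R \<epsilon> U\<^sub>R V\<^sub>R E r\<close>: a possible result of the truncated decomposition
  \<open>R = U\<^sub>R V\<^sub>R + E\<close> with smallest rank \<open>r\<close> such that the Frobenius norm of \<open>E\<close>
  is at most \<open>\<epsilon>\<close>.
\<close>

definition is_truncated_svd ::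
  "real mat \<Rightarrow> real \<Rightarrow> real mat \<Rightarrow> real mat \<Rightarrow> real mat \<Rightarrow> nat \<Rightarrow> bool" where
  "is_truncated_svd R \<epsilon> U\<^sub>R V\<^sub>R E r \<longleftrightarrow>
     (\<exists>U \<sigma> V. is_svd R U \<sigma> V \<and>
        (let left = (\<lambda>q. first_cols q U);
             right = (\<lambda>q. mat_diag q \<sigma> * transpose_mat (first_cols q V));
             err = (\<lambda>q. R - left q * right q)
         in r = (LEAST q. q \<le> min (dim_row R) (dim_col R) \<and> mat_frob (err q) \<le> \<epsilon>) \<and>
            U\<^sub>R = left r \<and> V\<^sub>R = right r \<and> E = err r))"

text \<open>
  Unfolded cores \<open>U 1, \<dots>, U d\<close> with orthonormal columns, of mode sizes \<open>n 1, \<dots>, n d\<close> and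
  ranks \<open>r 0, \<dots>, r d\<close>, and the last core \<open>U (d + 1)\<close> of mode size \<open>N\<close> as a matrix
  (its trailing rank 1 is suppressed).
\<close>

definition unfolded_tt_cores ::
  "nat \<Rightarrow> (nat \<Rightarrow> nat) \<Rightarrow> nat \<Rightarrow> (nat \<Rightarrow> nat) \<Rightarrow> (nat \<Rightarrow> real mat) \<Rightarrow> bool" where
  "unfolded_tt_cores d n N r U \<longleftrightarrow>
     r 0 = 1 \<and>
     (\<forall>i\<in>{1..d}. U i \<in> carrier_mat (r (i - 1) * n i) (r i) \<and> orthonormal_cols (U i)) \<and>
     U (d + 1) \<in> carrier_mat (r d) N"

text \<open>
  \<open>tt_ice d n b r U Y \<epsilon> r' U'\<close>: on the cores \<open>U\<close> with ranks \<open>r\<close> and the new tensor \<open>Y\<close>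
  with batch size \<open>b\<close>, the algorithm can return the cores \<open>U'\<close> with ranks \<open>r'\<close>.
  The existential variables are the intermediate values of the run: unfoldings \<open>M i\<close> of the
  streamed tensor, padded cores \<open>P i\<close>, residuals \<open>R i\<close> and their truncated SVDs.
\<close>

definition tt_ice ::
  "nat \<Rightarrow> (nat \<Rightarrow> nat) \<Rightarrow> nat \<Rightarrow> (nat \<Rightarrow> nat) \<Rightarrow> (nat \<Rightarrow> real mat) \<Rightarrow> tensor \<Rightarrow>
   (nat \<Rightarrow> real) \<Rightarrow> (nat \<Rightarrow> nat) \<Rightarrow> (nat \<Rightarrow> real mat) \<Rightarrow> bool" where
  "tt_ice d n b r U Y \<epsilon> r' U' \<longleftrightarrow>
     (\<exists>M P R U\<^sub>R V\<^sub>R E r\<^sub>R.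
        r' 0 = 1 \<and>
        M 1 = reshape_mat Y (n 1) ((\<Prod>j=2..d. n j) * b) \<and>
        P 1 = U 1 \<and>
        (\<forall>i\<in>{1..d}.
           R i = (1\<^sub>m (r' (i - 1) * n i) - P i * transpose_mat (P i)) * M i \<and>
           is_truncated_svd (R i) (\<epsilon> i) (U\<^sub>R i) (V\<^sub>R i) (E i) (r\<^sub>R i) \<and>
           U' i = append_cols (P i) (U\<^sub>R i) \<and>
           r' i = r i + r\<^sub>R i \<and>
           P (i + 1) =
             (if i < d
              then reshape_mat
                     (tensor_of_mat
                        (append_zero_rows (r\<^sub>R i)
                           (reshape_mat (tensor_of_mat (U (i + 1)))
                              (r i) (n (i + 1) * r (i + 1)))))
                     (r' i * n (i + 1)) (r (i + 1))
              else append_zero_rows (r\<^sub>R d) (U (d + 1))) \<and>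
           M (i + 1) =
             (if i < d
              then reshape_mat (tensor_of_mat (transpose_mat (U' i) * M i))
                     (r' i * n (i + 1)) ((\<Prod>j=i+2..d. n j) * b)
              else transpose_mat (U' d) * M d)) \<and>
        U' (d + 1) = append_cols (P (d + 1)) (M (d + 1)))"

definition core :: "(nat \<Rightarrow> nat) \<Rightarrow> (nat \<Rightarrow> nat) \<Rightarrow> (nat \<Rightarrow> real mat) \<Rightarrow> nat \<Rightarrow> tensor" where
  "core n r U i = reshape (tensor_of_mat (U i)) [r (i - 1), n i, r i]"

text \<open>
  Successive contraction of the first \<open>d\<close> cores and the last \<open>b\<close> columns of \<open>U (d + 1)\<close>.
  The contraction has mode sizes \<open>[1, n 1, \<dots>, n d, b]\<close>; the outer
  reshape only drops the leading 1.
\<close>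

definition tt_last_batch ::
  "nat \<Rightarrow> (nat \<Rightarrow> nat) \<Rightarrow> nat \<Rightarrow> (nat \<Rightarrow> nat) \<Rightarrow> (nat \<Rightarrow> real mat) \<Rightarrow> tensor" where
  "tt_last_batch d n b r U =
     reshape
       (foldl contract (core n r U 1)
          (map (core n r U) [2..<d+1] @ [tensor_of_mat (last_cols b (U (d + 1)))]))
       (map n [1..<d+1] @ [b])"

end

theory Submission
  imports Defs
begin

text \<open>
  Let \<open>M\<^sub>i\<close> be the matrix that the algorithm fits at mode \<open>i\<close>: the unfolded streamed tensor for
  \<open>i = 1\<close>, and the reshaped coefficients \<open>U'\<^bsub>i-1\<^esub>\<^sup>T M\<^bsub>i-1\<^esub>\<close> afterwards. Let \<open>Z\<^sub>i\<close> be the contraction of the updated cores \<open>i, \<dots>, d\<close> with the last columns of the final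
  core, read as a matrix with one row for each value of the leading rank index (\<open>tail i\<close> below).
  Since a reshape only renames entries, the entries of \<open>Z\<^sub>i\<close> are those of \<open>U'\<^sub>i Z\<^bsub>i+1\<^esub>\<close>, the
  part of the TT-approximation that stands for \<open>M\<^sub>i\<close>. The approximation of the whole tensor is
  \<open>Z\<^sub>1\<close>, because contracting cores is associative (\<open>foldl_contract_cores\<close>).

  The updated basis \<open>U'\<^sub>i\<close> has orthonormal columns, and projecting \<open>M\<^sub>i\<close> onto its column space
  leaves exactly the part of the residual that the truncation discards, of norm at most
  \<open>\<epsilon>\<^sub>i\<close> (\<open>extended_basis\<close>). The difference of this projection and \<open>U'\<^sub>i Z\<^bsub>i+1\<^esub>\<close> lies in the
  column space, hence is orthogonal to the discarded part, and multiplication by \<open>U'\<^sub>i\<close> is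
  isometric. Pythagoras (\<open>mat_frob_orthonormal_fit\<close>) therefore gives
  \<open>\<parallel>M\<^sub>i - U'\<^sub>i Z\<^bsub>i+1\<^esub>\<parallel>\<^sup>2 = \<parallel>M\<^sub>i - U'\<^sub>i U'\<^sub>i\<^sup>T M\<^sub>i\<parallel>\<^sup>2 + \<parallel>U'\<^sub>i\<^sup>T M\<^sub>i - Z\<^bsub>i+1\<^esub>\<parallel>\<^sup>2\<close>.
  For \<open>i < d\<close> the last difference becomes \<open>M\<^bsub>i+1\<^esub> - U'\<^bsub>i+1\<^esub> Z\<^bsub>i+2\<^esub>\<close> when reshaped, which is the
  situation of the next mode, and for \<open>i = d\<close> it vanishes, as the algorithm stores \<open>U'\<^sub>d\<^sup>T M\<^sub>d\<close> in the last columns of the final core. So the squared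
  errors of the \<open>d\<close> steps add up, without any error being amplified by later steps.
\<close>

section \<open>Linear indices and reshaping\<close>

lemma indices_Nil: "indices [] = {[]}"
  by (auto simp: indices_def)

lemma Cons_mem_indices [simp]: "i # is \<in> indices (d # ds) \<longleftrightarrow> i < d \<and> is \<in> indices ds"
  by (auto simp: indices_def nth_Cons' All_less_Suc2)

lemma indices_ConsE:
  assumes "is \<in> indices (d # ds)"
  obtains i "is'" where "is = i # is'" "i < d" "is' \<in> indices ds"
  using assms by (cases "is") (auto simp: indices_def All_less_Suc2)

text \<open>
  Here \<open>i\<close> is a position inside a block of length \<open>d\<close> and \<open>c\<close> the number of the block.
  Column-major indices are nested from such pairs.
\<close>

lemma mixed_radix_less: "i + d * c < d * m" if "i < d" "c < m" for i d c m :: nat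
proof -
  have "i + d * c < d * Suc c" using that by simp
  also have "\<dots> \<le> d * m" using that by (intro mult_le_mono2) simp
  finally show ?thesis .
qed

lemma lin_index_less: "is \<in> indices ds \<Longrightarrow> lin_index ds is < prod_list ds"
  by (induction ds arbitrary: "is") (auto elim!: indices_ConsE simp: indices_Nil mixed_radix_less)

lemma multi_index_lin_index: "is \<in> indices ds \<Longrightarrow> multi_index ds (lin_index ds is) = is"
  by (induction ds arbitrary: "is") (auto elim!: indices_ConsE simp: indices_Nil)

lemma multi_index_mem_indices: "k < prod_list ds \<Longrightarrow> multi_index ds k \<in> indices ds"
proof (induction ds arbitrary: k)
  case (Cons d ds)
  then have "d > 0" by (cases d) auto
  with Cons show ?case by (simp add: div_less_iff_less_mult mult.commute)
qed (simp add: indices_Nil)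

lemma lin_index_multi_index: "k < prod_list ds \<Longrightarrow> lin_index ds (multi_index ds k) = k"
proof (induction ds arbitrary: k)
  case (Cons d ds)
  then have "d > 0" by (cases d) auto
  with Cons show ?case by (simp add: div_less_iff_less_mult mult.commute)
qed simp

lemma bij_betw_lin_index: "bij_betw (lin_index ds) (indices ds) {..<prod_list ds}"
  by (rule bij_betw_byWitness[where f' = "multi_index ds"])
     (auto simp: multi_index_lin_index lin_index_multi_index lin_index_less multi_index_mem_indices)

lemma sum_indices_lin_index:
  "(\<Sum>is\<in>indices ds. f (lin_index ds is)) = (\<Sum>k<prod_list ds. f k)"
  by (rule sum.reindex_bij_betw[OF bij_betw_lin_index])

lemma sum_indices: "(\<Sum>is\<in>indices ds. f is) = (\<Sum>k<prod_list ds. f (multi_index ds k))"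
  unfolding sum_indices_lin_index[symmetric] by (simp add: multi_index_lin_index)

text \<open>
  Reading a linear index as a column-major matrix position turns a sum over it into a double sum;
  this relates Frobenius norms of tensors and of their unfoldings.
\<close>

lemma sum_mixed_radix:
  "(\<Sum>k<r * m. f k) = (\<Sum>c<m. \<Sum>i<r. f (i + r * c))" for r m :: nat and f :: "nat \<Rightarrow> real"
proof (induction m)
  case (Suc m)
  have "(\<Sum>k<a + t. f k) = (\<Sum>k<a. f k) + (\<Sum>i<t. f (i + a))" for a t
    by (induction t) (simp_all add: add.commute add.left_commute)
  from this[of "r * m" r] Suc show ?case by (simp add: add.commute)
qed simp

lemma reshape_mat_carrier [simp]: "reshape_mat A p q \<in> carrier_mat p q"
  by (simp add: reshape_mat_def)

lemma dim_reshape_mat [simp]: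
  "dim_row (reshape_mat A p q) = p" "dim_col (reshape_mat A p q) = q"
  by (simp_all add: reshape_mat_def)

lemma index_reshape_mat:
  assumes "i < p" "j < q"
  shows "reshape_mat A p q $$ (i, j) = entry A (multi_index (dims A) (i + p * j))"
  using assms by (simp add: reshape_mat_def reshape_def)

text \<open>
  Reshaping never changes the linear index, so an entry is located by an equation between two
  linear indices; in all applications that equation is ring arithmetic.
\<close>

lemma index_reshape_mat_of_mat:
  assumes "i < p" "j < q" "a < dim_row A" "b < dim_col A" "i + p * j = a + dim_row A * b"
  shows "reshape_mat (tensor_of_mat A) p q $$ (i, j) = A $$ (a, b)"
  using assms by (simp add: index_reshape_mat tensor_of_mat_def)

lemma reshape_mat_index_cases:
  assumes "i < p" "j < q" "p * q = r * (s :: nat)"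
  obtains a b where "a < r" "b < s" "i + p * j = a + r * b"
proof
  have *: "i + p * j < r * s" using assms mixed_radix_less by metis
  then have "r > 0" by (cases r) auto
  with * show "(i + p * j) mod r < r" "(i + p * j) div r < s"
    by (auto simp: div_less_iff_less_mult mult.commute)
qed simp

text \<open>
  Only the linear index survives a reshape, so intermediate shapes are forgotten. In particular
  reshapes are undone by reshaping back, which lets the error be compared in either shape.
\<close>

lemma reshape_mat_reshape_mat:
  assumes "p * q = p' * q'"
  shows "reshape_mat (tensor_of_mat (reshape_mat A p q)) p' q' = reshape_mat A p' q'"
proof (rule eq_matI; simp)
  fix i j assume ij: "i < p'" "j < q'"
  from ij assms[symmetric] obtain a b where "a < p" "b < q" "i + p' * j = a + p * b"
    by (rule reshape_mat_index_cases)
  with ij show "reshape_mat (tensor_of_mat (reshape_mat A p q)) p' q' $$ (i, j) =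
      reshape_mat A p' q' $$ (i, j)"
    by (subst index_reshape_mat_of_mat[where a = a and b = b]) (auto simp: index_reshape_mat)
qed

lemma reshape_mat_tensor_of_mat: "reshape_mat (tensor_of_mat A) (dim_row A) (dim_col A) = A"
  by (rule eq_matI) (auto intro: index_reshape_mat_of_mat)

lemma reshape_mat_diff:
  assumes "A \<in> carrier_mat m k" "B \<in> carrier_mat m k" "p * q = m * k"
  shows "reshape_mat (tensor_of_mat (A - B)) p q =
    reshape_mat (tensor_of_mat A) p q - reshape_mat (tensor_of_mat B) p q"
proof (rule eq_matI; simp)
  fix i j assume ij: "i < p" "j < q"
  from ij assms(3) obtain a b where ab: "a < m" "b < k" "i + p * j = a + m * b"
    by (rule reshape_mat_index_cases)
  have *: "reshape_mat (tensor_of_mat C) p q $$ (i, j) = C $$ (a, b)" if "C \<in> carrier_mat m k" for C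
    using ij ab that by (intro index_reshape_mat_of_mat) auto
  show "reshape_mat (tensor_of_mat (A - B)) p q $$ (i, j) =
    reshape_mat (tensor_of_mat A) p q $$ (i, j) - reshape_mat (tensor_of_mat B) p q $$ (i, j)"
    using assms ab by (simp add: *[OF assms(1)] *[OF assms(2)] *[OF minus_carrier_mat[OF assms(2)]])
qed

lemma mat_frob_sq: "(mat_frob A)\<^sup>2 = (\<Sum>i<dim_row A. \<Sum>j<dim_col A. (A $$ (i, j))\<^sup>2)"
  unfolding mat_frob_def by (simp add: sum_nonneg)

lemma mat_frob_nonneg: "0 \<le> mat_frob A"
  unfolding mat_frob_def by (simp add: sum_nonneg)

lemma mat_frob_reshape_mat_sq:
  assumes "p * q = prod_list (dims A)"
  shows "(mat_frob (reshape_mat A p q))\<^sup>2 = (\<Sum>is\<in>indices (dims A). (entry A is)\<^sup>2)"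
  unfolding mat_frob_sq sum_indices assms[symmetric]
  by (subst sum.swap) (simp add: sum_mixed_radix index_reshape_mat)

lemma mat_frob_reshape_mat:
  assumes "p * q = dim_row A * dim_col A"
  shows "mat_frob (reshape_mat (tensor_of_mat A) p q) = mat_frob A"
proof -
  have "(mat_frob (reshape_mat (tensor_of_mat A) p' q'))\<^sup>2 =
      (\<Sum>is\<in>indices [dim_row A, dim_col A]. (entry (tensor_of_mat A) is)\<^sup>2)"
    if "p' * q' = dim_row A * dim_col A" for p' q'
    using that by (subst mat_frob_reshape_mat_sq) (simp_all add: tensor_of_mat_def)
  from this[OF assms] this[OF refl]
  have "(mat_frob (reshape_mat (tensor_of_mat A) p q))\<^sup>2 = (mat_frob A)\<^sup>2"
    by (simp add: reshape_mat_tensor_of_mat)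
  then show ?thesis
    by (rule power2_eq_imp_eq[OF _ mat_frob_nonneg mat_frob_nonneg])
qed

section \<open>Orthonormal columns\<close>

lemma index_mult_mat_sum:
  assumes "A \<in> carrier_mat m p" "B \<in> carrier_mat p q" "i < m" "j < q"
  shows "(A * B) $$ (i, j) = (\<Sum>l<p. A $$ (i, l) * B $$ (l, j))"
  using assms by (simp add: scalar_prod_def lessThan_atLeast0)

lemma orthonormal_colsD:
  assumes "orthonormal_cols A" "i < dim_col A" "j < dim_col A"
  shows "col A i \<bullet> col A j = (if i = j then 1 else 0)"
proof -
  have "(transpose_mat A * A) $$ (i, j) = 1\<^sub>m (dim_col A) $$ (i, j)"
    using assms(1) by (simp add: orthonormal_cols_def)
  with assms(2,3) show ?thesis by simp
qed

lemma orthonormal_colsI: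
  assumes "\<And>i j. i < dim_col A \<Longrightarrow> j < dim_col A \<Longrightarrow> col A i \<bullet> col A j = (if i = j then 1 else 0)"
  shows "orthonormal_cols A"
  unfolding orthonormal_cols_def by (rule eq_matI) (auto simp: assms)

text \<open>
  As the trace of the Gram matrix, the squared norm is visibly invariant under multiplication
  from the left by orthonormal columns.
\<close>

lemma mat_frob_sq_gram: "(mat_frob A)\<^sup>2 = (\<Sum>j<dim_col A. (transpose_mat A * A) $$ (j, j))"
  unfolding mat_frob_sq
  by (subst sum.swap) (simp add: scalar_prod_def power2_eq_square lessThan_atLeast0)

lemma mat_frob_orthonormal_mult:
  assumes "orthonormal_cols U" "U \<in> carrier_mat m p" "X \<in> carrier_mat p q"
  shows "(mat_frob (U * X))\<^sup>2 = (mat_frob X)\<^sup>2"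
proof -
  have "transpose_mat (U * X) * (U * X) = transpose_mat X * (transpose_mat U * (U * X))"
    using assms(2,3) by (simp add: transpose_mult[of U m p X q] assoc_mult_mat[of _ q p _ m _ q])
  also have "transpose_mat U * (U * X) = (transpose_mat U * U) * X"
    using assms(2,3) by (simp add: assoc_mult_mat[of _ p m _ p _ q])
  also have "\<dots> = X" using assms by (simp add: orthonormal_cols_def)
  finally show ?thesis using assms(2,3) by (simp only: mat_frob_sq_gram) simp
qed

lemma mat_frob_pythagoras:
  assumes "A \<in> carrier_mat m q" "B \<in> carrier_mat m q" "transpose_mat A * B = 0\<^sub>m q q"
  shows "(mat_frob (A + B))\<^sup>2 = (mat_frob A)\<^sup>2 + (mat_frob B)\<^sup>2"
proof -
  have "(\<Sum>i<m. A $$ (i, j) * B $$ (i, j)) = 0" if "j < q" for j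
  proof -
    have "(transpose_mat A * B) $$ (j, j) = 0" using assms(3) that by simp
    then show ?thesis using assms(1,2) that by (simp add: scalar_prod_def lessThan_atLeast0)
  qed
  then have "(\<Sum>j<q. \<Sum>i<m. 2 * (A $$ (i, j) * B $$ (i, j))) = 0"
    by (simp add: sum_distrib_left[symmetric])
  then have "(\<Sum>i<m. \<Sum>j<q. 2 * (A $$ (i, j) * B $$ (i, j))) = 0"
    by (subst sum.swap)
  then show ?thesis using assms(1,2)
    by (simp add: mat_frob_sq power2_sum sum.distrib mult.assoc)
qed

text \<open>
  The residual of the orthogonal projection onto the columns of \<open>U\<close> is orthogonal to every
  \<open>U * X\<close>. Any approximation of the form \<open>U * Z\<close> thus pays for the projection and for the
  deviation of the coefficients \<open>Z\<close> from the optimal ones, separately.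
\<close>

lemma mat_frob_orthonormal_fit:
  assumes U: "orthonormal_cols U" "U \<in> carrier_mat m p"
    and M: "M \<in> carrier_mat m q" and Z: "Z \<in> carrier_mat p q"
  shows "(mat_frob (M - U * Z))\<^sup>2 =
    (mat_frob (M - U * (transpose_mat U * M)))\<^sup>2 + (mat_frob (transpose_mat U * M - Z))\<^sup>2"
proof -
  let ?T = "transpose_mat U * M"
  let ?A = "M - U * ?T" and ?B = "U * (?T - Z)"
  have Ut: "transpose_mat U \<in> carrier_mat p m" using U(2) by simp
  note T = mult_carrier_mat[OF Ut M]
  note UT = mult_carrier_mat[OF U(2) T] and UZ = mult_carrier_mat[OF U(2) Z]
  have D: "?T - Z \<in> carrier_mat p q" using Z by (rule minus_carrier_mat)
  have A: "?A \<in> carrier_mat m q" using UT by (rule minus_carrier_mat)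
  note B = mult_carrier_mat[OF U(2) D]
  have "M - Y = (M - X) + (X - Y)" if "X \<in> carrier_mat m q" "Y \<in> carrier_mat m q" for X Y
    using that M by (intro eq_matI) auto
  from this[OF UT UZ] have split: "M - U * Z = ?A + ?B"
    by (simp only: mult_minus_distrib_mat[OF U(2) T Z])
  have "transpose_mat U * (U * ?T) = ?T"
    using U(1) T unfolding assoc_mult_mat[OF Ut U(2) T, symmetric] orthonormal_cols_def
    by (metis U(2) carrier_matD(2) left_mult_one_mat)
  then have "transpose_mat U * ?A = 0\<^sub>m p q"
    using T by (simp add: mult_minus_distrib_mat[OF Ut M UT] del: index_mult_mat)
  then have "transpose_mat ?A * U = 0\<^sub>m q p"
    using transpose_mult[OF Ut A] by simp
  then have "transpose_mat ?A * ?B = 0\<^sub>m q q"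
    using assoc_mult_mat[OF transpose_carrier_mat[THEN iffD2, OF A] U(2) D]
    by (simp only: left_mult_zero_mat[OF D])
  then show ?thesis
    unfolding split
    by (simp only: mat_frob_pythagoras[OF A B] mat_frob_orthonormal_mult[OF U D])
qed

section \<open>Extending a basis by the truncated singular vectors of a residual\<close>

lemma first_cols_carrier [simp]: "q \<le> dim_col A \<Longrightarrow> first_cols q A \<in> carrier_mat (dim_row A) q"
  by (rule carrier_matI) (simp_all add: first_cols_def)

lemma dim_first_cols [simp]:
  "dim_row (first_cols q A) = dim_row A" "q \<le> dim_col A \<Longrightarrow> dim_col (first_cols q A) = q"
  by (simp_all add: first_cols_def)

lemma index_first_cols [simp]:
  "q \<le> dim_col A \<Longrightarrow> i < dim_row A \<Longrightarrow> j < q \<Longrightarrow> first_cols q A $$ (i, j) = A $$ (i, j)"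
  by (simp add: first_cols_def mat_of_cols_index)

lemma col_first_cols [simp]: "q \<le> dim_col A \<Longrightarrow> j < q \<Longrightarrow> col (first_cols q A) j = col A j"
  by (rule eq_vecI) (auto simp: first_cols_def mat_of_cols_index)

lemma append_cols_carrier [simp]:
  "append_cols A B \<in> carrier_mat (dim_row A) (dim_col A + dim_col B)"
  by (rule carrier_matI) (simp_all add: append_cols_def)

lemma dim_append_cols [simp]:
  "dim_row (append_cols A B) = dim_row A" "dim_col (append_cols A B) = dim_col A + dim_col B"
  by (simp_all add: append_cols_def)

lemma index_append_cols:
  "i < dim_row A \<Longrightarrow> dim_row B = dim_row A \<Longrightarrow> j < dim_col A + dim_col B \<Longrightarrow>
   append_cols A B $$ (i, j) = (if j < dim_col A then A $$ (i, j) else B $$ (i, j - dim_col A))"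
  by (auto simp: append_cols_def mat_of_cols_index nth_append)

lemma col_append_cols:
  assumes "dim_row B = dim_row A" "j < dim_col A + dim_col B"
  shows "col (append_cols A B) j = (if j < dim_col A then col A j else col B (j - dim_col A))"
  using assms by (intro eq_vecI) (auto simp: index_append_cols)

lemma orthonormal_append_cols:
  assumes "orthonormal_cols A" "orthonormal_cols B" "dim_row B = dim_row A"
    and "transpose_mat A * B = 0\<^sub>m (dim_col A) (dim_col B)"
  shows "orthonormal_cols (append_cols A B)"
proof (rule orthonormal_colsI)
  have AB: "col A i \<bullet> col B j = 0" if "i < dim_col A" "j < dim_col B" for i j
  proof -
    have "(transpose_mat A * B) $$ (i, j) = 0" using assms(4) that by simp
    with that show ?thesis by simp
  qed
  have BA: "col B j \<bullet> col A i = 0" if "i < dim_col A" "j < dim_col B" for i j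
    using AB[OF that] comm_scalar_prod[OF col_dim[of A i] col_dim[of B j, unfolded assms(3)]]
    by simp
  fix i j assume "i < dim_col (append_cols A B)" "j < dim_col (append_cols A B)"
  then have "i < dim_col A + dim_col B" "j < dim_col A + dim_col B" by simp_all
  then show "col (append_cols A B) i \<bullet> col (append_cols A B) j = (if i = j then 1 else 0)"
    using assms AB BA by (auto simp: col_append_cols orthonormal_colsD)
qed

text \<open>
  The projection sums the rank-one maps of the single columns, and so splits along any division
  of the columns into two blocks.
\<close>

lemma append_cols_projection:
  assumes "A \<in> carrier_mat m p" "B \<in> carrier_mat m s" "M \<in> carrier_mat m q"
  shows "append_cols A B * (transpose_mat (append_cols A B) * M) =
    A * (transpose_mat A * M) + B * (transpose_mat B * M)"
proof (rule eq_matI)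
  let ?C = "append_cols A B"
  have C: "?C \<in> carrier_mat m (p + s)" using append_cols_carrier[of A B] assms by auto
  fix i j assume "i < dim_row (A * (transpose_mat A * M) + B * (transpose_mat B * M))"
    "j < dim_col (A * (transpose_mat A * M) + B * (transpose_mat B * M))"
  then have ij: "i < m" "j < q" using assms by auto
  have split: "(\<Sum>k<p + s. f k) = (\<Sum>k<p. f k) + (\<Sum>k<s. f (p + k))" for f :: "nat \<Rightarrow> real"
    by (induction s) (auto simp: add.assoc)
  have ent: "(X * (transpose_mat X * M)) $$ (i, j) = (\<Sum>k<t. X $$ (i, k) * (col X k \<bullet> col M j))"
    if "X \<in> carrier_mat m t" for X t
    using that assms(3) ij by (simp add: scalar_prod_def lessThan_atLeast0)
  show "(?C * (transpose_mat ?C * M)) $$ (i, j) =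
      (A * (transpose_mat A * M) + B * (transpose_mat B * M)) $$ (i, j)"
    using assms ij by (simp add: ent[OF C] ent[OF assms(1)] ent[OF assms(2)] split index_append_cols
        col_append_cols del: index_mult_mat(1))
qed (use assms append_cols_carrier[of A B] in auto)

text \<open>
  What the algorithm needs from a truncated decomposition, free of the underlying full one. The
  factor \<open>W\<close> shows that the retained singular vectors lie in the column space of \<open>R\<close>; it
  divides by the retained singular values. These are positive because the rank is minimal:
  if the last one were zero, dropping it would not change the error.
\<close>

lemma is_truncated_svdE:
  assumes "is_truncated_svd R \<epsilon> U\<^sub>R V\<^sub>R E s" "0 \<le> \<epsilon>"
  obtains "U\<^sub>R \<in> carrier_mat (dim_row R) s" "orthonormal_cols U\<^sub>R"
    "mat_frob (R - U\<^sub>R * (transpose_mat U\<^sub>R * R)) \<le> \<epsilon>"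
    "\<exists>W \<in> carrier_mat (dim_col R) s. U\<^sub>R = R * W"
proof -
  define m q p where "m = dim_row R" and "q = dim_col R" and "p = min m q"
  from assms(1) obtain U \<sigma> V where svd: "is_svd R U \<sigma> V"
    and s: "s = (LEAST t. t \<le> p \<and>
        mat_frob (R - first_cols t U * (mat_diag t \<sigma> * transpose_mat (first_cols t V))) \<le> \<epsilon>)"
    and UR: "U\<^sub>R = first_cols s U"
    unfolding is_truncated_svd_def Let_def m_def q_def p_def by blast
  from svd have U: "U \<in> carrier_mat m p" "orthonormal_cols U"
    and V: "V \<in> carrier_mat q p" "orthonormal_cols V"
    and \<sigma>: "\<And>j. j < p \<Longrightarrow> 0 \<le> \<sigma> j" "\<And>i j. i \<le> j \<Longrightarrow> j < p \<Longrightarrow> \<sigma> j \<le> \<sigma> i"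
    and R: "R = U * mat_diag p \<sigma> * transpose_mat V"
    unfolding is_svd_def Let_def m_def q_def p_def by blast+
  have Rc: "R \<in> carrier_mat m q" by (rule carrier_matI) (simp_all add: m_def q_def)
  (* S t is the right factor of rank t, err t the error of truncating at rank t. *)
  define S where "S t = mat_diag t \<sigma> * transpose_mat (first_cols t V)" for t
  define err where "err t = R - first_cols t U * S t" for t
  have S_dim [simp]: "dim_row (S t) = t" "dim_col (S t) = q" for t
    using V by (simp_all add: S_def mat_diag_def)
  have S: "S t \<in> carrier_mat t q" for t
    by (rule carrier_matI) simp_all
  have S_index: "S t $$ (k, j) = \<sigma> k * V $$ (j, k)" if "t \<le> p" "k < t" "j < q" for t k j
    using V that first_cols_carrier[of t V] unfolding S_def
    by (subst mat_diag_mult_left[of _ t q]) auto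
  have Uc: "first_cols t U \<in> carrier_mat m t" if "t \<le> p" for t
    using U that by (intro carrier_matI) simp_all
  have UtRow: "(first_cols t U * S t) $$ (i, j) = (\<Sum>k<t. U $$ (i, k) * (\<sigma> k * V $$ (j, k)))"
    if "t \<le> p" "i < m" "j < q" for t i j
    unfolding index_mult_mat_sum[OF Uc[OF that(1)] S that(2,3)]
    using U that by (simp add: S_index)
  have full: "R = U * S p"
  proof -
    have "first_cols p V = V" using V first_cols_carrier[of p V] by (intro eq_matI) auto
    then show ?thesis using U V
      by (subst R) (simp add: S_def assoc_mult_mat[of _ m p _ p _ q])
  qed
  (* Some rank is admissible: the full decomposition has error 0. *)
  have "first_cols p U = U" using U first_cols_carrier[of p U] by (intro eq_matI) auto
  then have "err p = 0\<^sub>m m q" using Rc by (simp add: err_def full[symmetric])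
  then have "mat_frob (err p) \<le> \<epsilon>" using assms(2) by (simp add: mat_frob_def)
  then have ex: "p \<le> p \<and> mat_frob (err p) \<le> \<epsilon>" by simp
  have s': "s = (LEAST t. t \<le> p \<and> mat_frob (err t) \<le> \<epsilon>)" by (simp add: s err_def S_def)
  have sp: "s \<le> p" "mat_frob (err s) \<le> \<epsilon>"
    using LeastI[of "\<lambda>t. t \<le> p \<and> mat_frob (err t) \<le> \<epsilon>", OF ex] by (simp_all add: s')
  have minimal: "\<not> mat_frob (err t) \<le> \<epsilon>" if "t < s" for t
    using not_less_Least[of t "\<lambda>t. t \<le> p \<and> mat_frob (err t) \<le> \<epsilon>"] that sp by (simp add: s')
  have pos: "0 < \<sigma> j" if "j < s" for j
  proof -
    from that obtain t where t: "s = Suc t" by (cases s) auto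
    have "\<sigma> t \<noteq> 0"
    proof
      assume "\<sigma> t = 0"
      then have "err s = err t" using sp t U Rc
        by (intro eq_matI) (auto simp: err_def UtRow simp del: index_mult_mat(1))
      with minimal[of t] sp t show False by simp
    qed
    then have "0 < \<sigma> t" using \<sigma>(1)[of t] sp t by simp
    also have "\<sigma> t \<le> \<sigma> j" using \<sigma>(2)[of j t] sp t that by simp
    finally show ?thesis .
  qed
  have URc: "U\<^sub>R \<in> carrier_mat m s" using U sp first_cols_carrier[of s U] by (simp add: UR)
  have URo: "orthonormal_cols U\<^sub>R"
    using U sp URc by (intro orthonormal_colsI) (auto simp: UR orthonormal_colsD)
  have "transpose_mat U\<^sub>R * R = S s"
  proof (rule eq_matI)
    fix k j assume "k < dim_row (S s)" "j < dim_col (S s)"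
    then have kj: "k < s" "j < q" using S sp by auto
    have "transpose_mat U\<^sub>R * R = transpose_mat U\<^sub>R * U * S p"
      using URc U S[of p] by (subst full) (simp add: assoc_mult_mat[of _ s m _ p _ q])
    also have "\<dots> $$ (k, j) = (\<Sum>l<p. (transpose_mat U\<^sub>R * U) $$ (k, l) * S p $$ (l, j))"
      using URc U by (intro index_mult_mat_sum[OF _ S kj]) auto
    also have "\<dots> = (\<Sum>l<p. (col U\<^sub>R k \<bullet> col U l) * S p $$ (l, j))"
      using URc U kj by (intro sum.cong) auto
    also have "\<dots> = (\<Sum>l<p. if l = k then S p $$ (l, j) else 0)"
      using U sp kj by (intro sum.cong) (auto simp: UR orthonormal_colsD)
    also have "\<dots> = S s $$ (k, j)" using kj sp by (simp add: S_index)
    finally show "(transpose_mat U\<^sub>R * R) $$ (k, j) = S s $$ (k, j)" .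
  qed (use URc Rc S sp in auto)
  then have err: "mat_frob (R - U\<^sub>R * (transpose_mat U\<^sub>R * R)) \<le> \<epsilon>"
    using sp by (simp add: err_def UR)
  (* R V = U \<Sigma>, so the columns of V divided by the singular values are sent to those of U. *)
  define W where "W = mat q s (\<lambda>(j, k). V $$ (j, k) / \<sigma> k)"
  have Wc: "W \<in> carrier_mat q s" by (simp add: W_def)
  have "U\<^sub>R = R * W"
  proof (rule eq_matI)
    fix i k assume "i < dim_row (R * W)" "k < dim_col (R * W)"
    then have ik: "i < m" "k < s" using Rc by (auto simp: W_def)
    have SW: "S p * W \<in> carrier_mat p s" using S[of p] by (simp add: W_def)
    have SWe: "(S p * W) $$ (l, k) = (if l = k then 1 else 0)" if "l < p" for l
    proof -
      have "(S p * W) $$ (l, k) = (\<Sum>j<q. \<sigma> l * V $$ (j, l) * (V $$ (j, k) / \<sigma> k))"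
        unfolding index_mult_mat_sum[OF S Wc that ik(2)] using that ik by (simp add: W_def S_index)
      also have "\<dots> = \<sigma> l / \<sigma> k * (col V l \<bullet> col V k)"
        using that V ik sp by (simp add: scalar_prod_def lessThan_atLeast0 sum_distrib_left mult_ac)
      also have "\<dots> = (if l = k then 1 else 0)"
        using that V ik sp pos[of k] by (simp add: orthonormal_colsD)
      finally show ?thesis .
    qed
    have "R * W = U * (S p * W)"
      using U S[of p] by (subst full) (simp add: assoc_mult_mat[of _ m p _ q _ s] W_def)
    also have "\<dots> $$ (i, k) = (\<Sum>l<p. U $$ (i, l) * (S p * W) $$ (l, k))"
      by (rule index_mult_mat_sum[OF U(1) SW ik])
    also have "\<dots> = (\<Sum>l<p. if l = k then U $$ (i, l) else 0)"
      by (intro sum.cong) (auto simp: SWe)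
    also have "\<dots> = U\<^sub>R $$ (i, k)" using ik U sp by (simp add: UR)
    finally show "U\<^sub>R $$ (i, k) = (R * W) $$ (i, k)" ..
  qed (use URc Rc in \<open>auto simp: W_def\<close>)
  with Wc show thesis using that URc URo err sp unfolding m_def q_def p_def by blast
qed

text \<open>
  One step of the algorithm. The residual \<open>R\<close> is orthogonal to the columns of \<open>P\<close>, hence so
  are the singular vectors taken from its column space, and appending them to \<open>P\<close> keeps the
  columns orthonormal. By the same orthogonality the new vectors have the same inner products
  with \<open>M\<close> as with \<open>R\<close>, so the projection error of \<open>M\<close> is the truncation error of \<open>R\<close>.
\<close>

lemma extended_basis:
  assumes P: "P \<in> carrier_mat m p" "orthonormal_cols P" and M: "M \<in> carrier_mat m q"
    and R: "R = (1\<^sub>m m - P * transpose_mat P) * M"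
    and svd: "is_truncated_svd R \<epsilon> U\<^sub>R V\<^sub>R E s" and \<epsilon>: "0 \<le> \<epsilon>"
  shows "append_cols P U\<^sub>R \<in> carrier_mat m (p + s)"
    and "orthonormal_cols (append_cols P U\<^sub>R)"
    and "mat_frob (M - append_cols P U\<^sub>R * (transpose_mat (append_cols P U\<^sub>R) * M)) \<le> \<epsilon>"
proof -
  let ?Pt = "transpose_mat P"
  have PM: "?Pt * M \<in> carrier_mat p q" using P M by simp
  have R': "R = M - P * (?Pt * M)"
    using P M unfolding R
    by (subst minus_mult_distrib_mat[of _ m m _ _ q]) (auto simp: assoc_mult_mat[of _ m p _ m _ q])
  have Pt: "?Pt \<in> carrier_mat p m" using P by simp
  have PPM: "P * (?Pt * M) \<in> carrier_mat m q" using P(1) PM by (rule mult_carrier_mat)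
  have Rc: "R \<in> carrier_mat m q" unfolding R' using PPM by (rule minus_carrier_mat)
  have "?Pt * R = ?Pt * M - ?Pt * P * (?Pt * M)"
    unfolding R' mult_minus_distrib_mat[OF Pt M PPM] assoc_mult_mat[OF Pt P(1) PM] ..
  moreover have "?Pt * P = 1\<^sub>m p" using P by (simp add: orthonormal_cols_def)
  ultimately have PR: "?Pt * R = 0\<^sub>m p q"
    by (simp only: left_mult_one_mat[OF PM] minus_r_inv_mat[OF PM])
  from svd \<epsilon> Rc obtain W where UR: "U\<^sub>R \<in> carrier_mat m s" "orthonormal_cols U\<^sub>R"
    and err: "mat_frob (R - U\<^sub>R * (transpose_mat U\<^sub>R * R)) \<le> \<epsilon>"
    and W: "W \<in> carrier_mat q s" "U\<^sub>R = R * W"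
    by (elim is_truncated_svdE) auto
  have "?Pt * U\<^sub>R = ?Pt * R * W" using P Rc W by (simp add: assoc_mult_mat[of _ p m _ q _ s])
  then have PUR: "?Pt * U\<^sub>R = 0\<^sub>m p s" using W PR by simp
  then have URP: "transpose_mat U\<^sub>R * P = 0\<^sub>m s p"
    using transpose_mult[of ?Pt p m U\<^sub>R s] P UR by (simp add: zero_transpose_mat)
  have URt: "transpose_mat U\<^sub>R \<in> carrier_mat s m" using UR by simp
  have "transpose_mat U\<^sub>R * R = transpose_mat U\<^sub>R * M - transpose_mat U\<^sub>R * P * (?Pt * M)"
    unfolding R' mult_minus_distrib_mat[OF URt M PPM] assoc_mult_mat[OF URt P(1) PM] ..
  then have URR: "transpose_mat U\<^sub>R * R = transpose_mat U\<^sub>R * M"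
    unfolding URP left_mult_zero_mat[OF PM] using URt M by (intro eq_matI) auto
  show "append_cols P U\<^sub>R \<in> carrier_mat m (p + s)"
    using append_cols_carrier[of P U\<^sub>R] P UR by auto
  show "orthonormal_cols (append_cols P U\<^sub>R)"
    using P UR PUR by (intro orthonormal_append_cols) auto
  have "M - append_cols P U\<^sub>R * (transpose_mat (append_cols P U\<^sub>R) * M) =
      R - U\<^sub>R * (transpose_mat U\<^sub>R * R)"
    using P M PM UR unfolding URR unfolding R'
    by (subst append_cols_projection[of _ m p _ s _ q]) (auto intro!: eq_matI simp del: index_mult_mat(1))
  with err show "mat_frob (M - append_cols P U\<^sub>R * (transpose_mat (append_cols P U\<^sub>R) * M)) \<le> \<epsilon>"
    by simp
qed

text \<open>
  The core \<open>A\<close> has \<open>n\<close> blocks of \<open>r\<close> rows, one block for each value of the mode index.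
  Raising the leading rank to \<open>r + s\<close> extends each block by \<open>s\<close> zero rows, which contribute
  nothing to inner products of columns.
\<close>

lemma orthonormal_padded_core:
  assumes A: "A \<in> carrier_mat (r * n) q" "orthonormal_cols A"
  shows "orthonormal_cols (reshape_mat (tensor_of_mat (append_zero_rows s
    (reshape_mat (tensor_of_mat A) r (n * q)))) ((r + s) * n) q)" (is "orthonormal_cols ?B")
proof (rule orthonormal_colsI)
  let ?C = "reshape_mat (tensor_of_mat A) r (n * q)"
  have C: "append_zero_rows s ?C \<in> carrier_mat (r + s) (n * q)"
    by (simp add: append_zero_rows_def carrier_append_rows)
  have B: "?B $$ (k + (r + s) * y, l) = (if k < r then A $$ (k + r * y, l) else 0)"
    if "k < r + s" "y < n" "l < q" for k y l
  proof -
    have C_index: "?C $$ (k, y + n * l) = A $$ (k + r * y, l)" if "k < r"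
      using that \<open>y < n\<close> \<open>l < q\<close> A mixed_radix_less[OF that, of y n] mixed_radix_less[of y n l q]
      by (intro index_reshape_mat_of_mat) (auto simp: algebra_simps)
    have "?B $$ (k + (r + s) * y, l) = append_zero_rows s ?C $$ (k, y + n * l)"
      using that C mixed_radix_less[of k "r + s" y n] mixed_radix_less[of y n l q]
      by (intro index_reshape_mat_of_mat) (auto simp: algebra_simps)
    also have "\<dots> = (if k < r then ?C $$ (k, y + n * l) else 0)"
      using that mixed_radix_less[of y n l q]
      by (simp add: append_zero_rows_def append_rows_def)
    finally show ?thesis using C_index by simp
  qed
  fix i j assume "i < dim_col ?B" "j < dim_col ?B"
  then have ij: "i < q" "j < q" by simp_all
  have "col ?B i \<bullet> col ?B j = (\<Sum>t<(r + s) * n. ?B $$ (t, i) * ?B $$ (t, j))"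
    using ij by (simp add: scalar_prod_def lessThan_atLeast0)
  also have "\<dots> = (\<Sum>y<n. \<Sum>k<r + s. if k < r then A $$ (k + r * y, i) * A $$ (k + r * y, j) else 0)"
    unfolding sum_mixed_radix using ij by (intro sum.cong) (auto simp: B)
  also have "\<dots> = (\<Sum>y<n. \<Sum>k<r. A $$ (k + r * y, i) * A $$ (k + r * y, j))"
    by (intro sum.cong refl sum.mono_neutral_cong_right) auto
  also have "\<dots> = (\<Sum>t<r * n. A $$ (t, i) * A $$ (t, j))"
    by (simp add: sum_mixed_radix)
  also have "\<dots> = col A i \<bullet> col A j"
    using A ij by (simp add: scalar_prod_def lessThan_atLeast0)
  finally show "col ?B i \<bullet> col ?B j = (if i = j then 1 else 0)"
    using A ij by (simp add: orthonormal_colsD)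
qed

section \<open>Contraction of tensor train cores from the right\<close>

text \<open>
  The last factor \<open>L\<close> is kept apart from the cores, since only some columns of the final core
  take part in the contraction.
\<close>

locale tt_cores =
  fixes d b :: nat and n r :: "nat \<Rightarrow> nat" and U :: "nat \<Rightarrow> real mat" and L :: "real mat"
  assumes U_carrier: "\<And>i. i \<in> {1..d} \<Longrightarrow> U i \<in> carrier_mat (r (i - 1) * n i) (r i)"
    and L_carrier: "L \<in> carrier_mat (r d) b"
begin

definition modes :: "nat \<Rightarrow> nat list" where
  "modes i = map n [i..<Suc d] @ [b]"

lemma modes_last: "modes (Suc d) = [b]"
  by (simp add: modes_def)

lemma modes_Cons: "i \<le> d \<Longrightarrow> modes i = n i # modes (Suc i)"
  by (simp add: modes_def upt_conv_Cons del: upt_Suc)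

lemma prod_list_modes: "prod_list (modes i) = (\<Prod>j=i..d. n j) * b"
  by (simp add: modes_def prod.distinct_set_conv_list[symmetric]
      atLeastLessThanSuc_atLeastAtMost del: upt_Suc)

text \<open>
  The contraction of the cores \<open>i, \<dots>, d\<close> with \<open>L\<close>. Associated from the right, each
  contraction is a matrix product followed by a reshape that moves the mode index from the rows
  to the columns. Orthonormality of the cores can be used in this form, whereas the
  association from the left defines the TT-format.
\<close>

function tail :: "nat \<Rightarrow> real mat" where
  "tail i =
    (if i \<le> d
     then reshape_mat (tensor_of_mat (U i * tail (Suc i))) (r (i - 1)) (prod_list (modes i))
     else L)"
  by pat_completeness auto
termination by (relation "measure (\<lambda>i. Suc d - i)") auto

declare tail.simps [simp del]

lemma tail_last: "tail (Suc d) = L"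
  by (simp add: tail.simps)

lemma tail_step:
  "i \<le> d \<Longrightarrow>
   tail i = reshape_mat (tensor_of_mat (U i * tail (Suc i))) (r (i - 1)) (prod_list (modes i))"
  by (subst tail.simps) simp

lemma tail_carrier: "i \<le> Suc d \<Longrightarrow> tail i \<in> carrier_mat (r (i - 1)) (prod_list (modes i))"
  using L_carrier by (cases "i = Suc d") (simp_all add: tail_last modes_last tail_step)

lemma index_tail:
  assumes i: "i \<in> {1..d}" and k: "k < r (i - 1)" and y: "y < n i"
    and c: "c < prod_list (modes (Suc i))"
  shows "tail i $$ (k, y + n i * c) =
    (\<Sum>l<r i. U i $$ (k + r (i - 1) * y, l) * tail (Suc i) $$ (l, c))"
proof -
  have T: "tail (Suc i) \<in> carrier_mat (r i) (prod_list (modes (Suc i)))"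
    using tail_carrier[of "Suc i"] i by simp
  have row: "k + r (i - 1) * y < r (i - 1) * n i" using k y by (rule mixed_radix_less)
  have col: "y + n i * c < prod_list (modes i)"
    using mixed_radix_less[OF y c] i by (simp add: modes_Cons)
  have dims: "dim_row (U i * tail (Suc i)) = r (i - 1) * n i"
    "dim_col (U i * tail (Suc i)) = prod_list (modes (Suc i))"
    using U_carrier[OF i] T by auto
  have "i \<le> d" using i by simp
  then have "tail i $$ (k, y + n i * c) = (U i * tail (Suc i)) $$ (k + r (i - 1) * y, c)"
    unfolding tail_step[OF \<open>i \<le> d\<close>] using k col row c
    by (intro index_reshape_mat_of_mat) (simp_all add: dims algebra_simps del: index_mult_mat)
  then show ?thesis unfolding index_mult_mat_sum[OF U_carrier[OF i] T row c] .
qed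

lemma entry_core:
  assumes i: "i \<in> {1..d}" and "k < r (i - 1)" "y < n i" "l < r i"
  shows "entry (core n r U i) [k, y, l] = U i $$ (k + r (i - 1) * y, l)"
proof -
  have row: "k + r (i - 1) * y < r (i - 1) * n i" using assms by (simp add: mixed_radix_less)
  have "lin_index [r (i - 1), n i, r i] [k, y, l] = (k + r (i - 1) * y) + r (i - 1) * n i * l"
    by (simp add: algebra_simps)
  then show ?thesis using assms row U_carrier[OF i]
    by (simp add: core_def reshape_def tensor_of_mat_def del: lin_index.simps)
qed

text \<open>
  Associativity of contraction: contracting a tensor \<open>A\<close> with the remaining cores one after
  another is contracting it once with their tail. The induction runs downward from the last
  core, with \<open>A\<close> general because it absorbs one core in each step.
\<close>

lemma foldl_contract_cores:
  assumes "1 \<le> i" "i \<le> Suc d" "dims A = ds @ [r (i - 1)]"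
  defines "T \<equiv> foldl contract A (map (core n r U) [i..<Suc d] @ [tensor_of_mat L])"
  shows "dims T = ds @ modes i \<and>
    (\<forall>xs ys. length xs = length ds \<longrightarrow> ys \<in> indices (modes i) \<longrightarrow>
      entry T (xs @ ys) =
      (\<Sum>k<r (i - 1). entry A (xs @ [k]) * tail i $$ (k, lin_index (modes i) ys)))"
  unfolding T_def using assms(2,1,3)
proof (induction i arbitrary: A ds rule: inc_induct)
  case base
  have T: "foldl contract A (map (core n r U) [Suc d..<Suc d] @ [tensor_of_mat L]) =
      contract A (tensor_of_mat L)" by simp
  show ?case unfolding T
  proof (intro conjI allI impI)
    show "dims (contract A (tensor_of_mat L)) = ds @ modes (Suc d)"
      using base L_carrier by (simp add: contract_def Let_def tensor_of_mat_def modes_last)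
    fix xs ys :: "nat list"
    assume xs: "length xs = length ds" and "ys \<in> indices (modes (Suc d))"
    then obtain j where ys: "ys = [j]"
      by (auto elim!: indices_ConsE simp: indices_Nil modes_last)
    show "entry (contract A (tensor_of_mat L)) (xs @ ys) = (\<Sum>k<r (Suc d - 1).
        entry A (xs @ [k]) * tail (Suc d) $$ (k, lin_index (modes (Suc d)) ys))"
      using base xs
      by (simp add: contract_def Let_def tensor_of_mat_def ys tail_last modes_last)
  qed
next
  case (step i)
  let ?A = "contract A (core n r U i)"
  let ?F = "foldl contract A (map (core n r U) [i..<Suc d] @ [tensor_of_mat L])"
  have i: "i \<in> {1..d}" "i \<le> d" using step by auto
  have F: "?F = foldl contract ?A (map (core n r U) [Suc i..<Suc d] @ [tensor_of_mat L])"
    using i by (simp add: upt_conv_Cons del: upt_Suc)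
  have dimsA: "dims ?A = (ds @ [n i]) @ [r (Suc i - 1)]"
    using step.prems by (simp add: contract_def Let_def core_def reshape_def)
  have "1 \<le> Suc i" by simp
  note IH = step.IH[OF this dimsA, folded F]
  show ?case
  proof (intro conjI allI impI)
    show "dims ?F = ds @ modes i"
      using conjunct1[OF IH] unfolding modes_Cons[OF i(2)] by simp
    fix xs ys :: "nat list"
    assume xs: "length xs = length ds" and "ys \<in> indices (modes i)"
    then obtain y zs where ys: "ys = y # zs" "y < n i" "zs \<in> indices (modes (Suc i))"
      unfolding modes_Cons[OF i(2)] by (auto elim!: indices_ConsE)
    let ?c = "lin_index (modes (Suc i)) zs"
    have A_index: "entry ?A (xs @ [y, l]) =
        (\<Sum>k<r (i - 1). entry A (xs @ [k]) * U i $$ (k + r (i - 1) * y, l))" if "l < r i" for l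
      using that xs step.prems ys(2) entry_core[OF i(1)] by (simp add: contract_def Let_def)
    have "entry ?F (xs @ ys) = (\<Sum>l<r i. entry ?A (xs @ [y, l]) * tail (Suc i) $$ (l, ?c))"
      using conjunct2[OF IH, rule_format, of "xs @ [y]" zs] xs ys by (simp del: upt_Suc)
    also have "\<dots> = (\<Sum>l<r i. \<Sum>k<r (i - 1). entry A (xs @ [k]) *
        (U i $$ (k + r (i - 1) * y, l) * tail (Suc i) $$ (l, ?c)))"
      by (intro sum.cong refl) (simp add: A_index sum_distrib_right mult.assoc)
    also have "\<dots> = (\<Sum>k<r (i - 1). entry A (xs @ [k]) *
        (\<Sum>l<r i. U i $$ (k + r (i - 1) * y, l) * tail (Suc i) $$ (l, ?c)))"
      by (subst sum.swap) (simp add: sum_distrib_left)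
    also have "\<dots> = (\<Sum>k<r (i - 1). entry A (xs @ [k]) * tail i $$ (k, y + n i * ?c))"
      using index_tail[OF i(1) _ ys(2) lin_index_less[OF ys(3)]] by (intro sum.cong refl) simp
    finally show "entry ?F (xs @ ys) =
        (\<Sum>k<r (i - 1). entry A (xs @ [k]) * tail i $$ (k, lin_index (modes i) ys))"
      unfolding modes_Cons[OF i(2)] ys(1) by simp
  qed
qed

lemma entry_tt_last_batch:
  assumes d: "1 \<le> d" and r0: "r 0 = 1" and L: "L = last_cols b (U (d + 1))"
    and ys: "ys \<in> indices (modes 1)"
  shows "entry (tt_last_batch d n b r U) ys = tail 1 $$ (0, lin_index (modes 1) ys)"
proof -
  let ?T = "foldl contract (core n r U 1) (map (core n r U) [2..<Suc d] @ [tensor_of_mat L])"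
  have one: "1 \<in> {1..d}" using d by simp
  have ms: "modes 1 = n 1 # modes 2" using modes_Cons[OF d] by (simp add: numeral_2_eq_2)
  from ys obtain y zs where y: "ys = y # zs" "y < n 1" "zs \<in> indices (modes 2)"
    unfolding ms by (auto elim!: indices_ConsE)
  have dimsC: "dims (core n r U 1) = [1, n 1] @ [r (2 - 1)]"
    by (simp add: core_def reshape_def r0)
  have "1 \<le> (2 :: nat)" "2 \<le> Suc d" using d by auto
  note T = foldl_contract_cores[OF this dimsC]
  have "dims ?T = 1 # modes 1" using conjunct1[OF T] unfolding ms by simp
  (* The outer reshape drops the leading mode of size 1, that is, prepends the index 0. *)
  then have "entry (tt_last_batch d n b r U) ys =
      entry ?T (multi_index (1 # modes 1) (lin_index (modes 1) ys))"
    by (simp add: tt_last_batch_def reshape_def L modes_def del: upt_Suc)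
  also have "\<dots> = entry ?T ([0, y] @ zs)"
    using multi_index_lin_index[OF ys] by (simp add: y(1) del: upt_Suc)
  also have "\<dots> = (\<Sum>l<r 1. entry (core n r U 1) [0, y, l] * tail 2 $$ (l, lin_index (modes 2) zs))"
    using conjunct2[OF T, rule_format, of "[0, y]" zs] y(3) by (simp del: upt_Suc)
  also have "\<dots> = (\<Sum>l<r 1. U 1 $$ (0 + r (1 - 1) * y, l) * tail 2 $$ (l, lin_index (modes 2) zs))"
    using y(2) r0 entry_core[OF one, of 0 y] by (intro sum.cong refl) simp
  also have "\<dots> = tail 1 $$ (0, y + n 1 * lin_index (modes 2) zs)"
    using index_tail[OF one, of 0 y "lin_index (modes 2) zs"] y lin_index_less[OF y(3)] r0
    by (simp add: numeral_2_eq_2)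
  finally show ?thesis unfolding ms y(1) by simp
qed

end

section \<open>The error bound\<close>

lemma last_cols_append_cols:
  assumes "dim_row B = dim_row A"
  shows "last_cols (dim_col B) (append_cols A B) = B"
proof -
  have "last_cols (dim_col B) (append_cols A B) = mat_of_cols (dim_row B) (cols B)"
    using append_cols_carrier[of A B] assms
    by (simp add: last_cols_def append_cols_def cols_mat_of_cols cols_dim[THEN subset_trans])
  then show ?thesis by simp
qed

theorem theorem2:
  fixes d k :: nat
    and n :: "nat \<Rightarrow> nat"
    and batch :: "nat \<Rightarrow> nat"
    and r r' :: "nat \<Rightarrow> nat"
    and U U' :: "nat \<Rightarrow> real mat"
    and Y :: tensor
    and \<epsilon> :: "nat \<Rightarrow> real"
  assumes "d \<ge> 1"
    and "unfolded_tt_cores d n (\<Sum>l=1..k. batch l) r U"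
    and "dims Y = map n [1..<d+1] @ [batch (k + 1)]"
    and "\<forall>i\<in>{1..d}. \<epsilon> i \<ge> 0"
    and "tt_ice d n (batch (k + 1)) r U Y \<epsilon> r' U'"
  shows "tensor_frob (tensor_minus Y (tt_last_batch d n (batch (k + 1)) r' U'))
         \<le> sqrt (\<Sum>i=1..d. (\<epsilon> i)\<^sup>2)"
proof -
  define b where "b = batch (k + 1)"
  (* Q i: number of columns of the tail starting at mode i. *)
  define Q where "Q i = (\<Prod>j=i..d. n j) * b" for i
  from assms(5)[folded b_def] obtain M P R U\<^sub>R V\<^sub>R E r\<^sub>R where
    r'0: "r' 0 = 1" and M1: "M 1 = reshape_mat Y (n 1) ((\<Prod>j=2..d. n j) * b)" and P1: "P 1 = U 1"
    and alg_step: "\<And>i. i \<in> {1..d} \<Longrightarrow>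
           R i = (1\<^sub>m (r' (i - 1) * n i) - P i * transpose_mat (P i)) * M i \<and>
           is_truncated_svd (R i) (\<epsilon> i) (U\<^sub>R i) (V\<^sub>R i) (E i) (r\<^sub>R i) \<and>
           U' i = append_cols (P i) (U\<^sub>R i) \<and>
           r' i = r i + r\<^sub>R i \<and>
           P (i + 1) =
             (if i < d
              then reshape_mat
                     (tensor_of_mat
                        (append_zero_rows (r\<^sub>R i)
                           (reshape_mat (tensor_of_mat (U (i + 1)))
                              (r i) (n (i + 1) * r (i + 1)))))
                     (r' i * n (i + 1)) (r (i + 1))
              else append_zero_rows (r\<^sub>R d) (U (d + 1))) \<and>
           M (i + 1) =
             (if i < d
              then reshape_mat (tensor_of_mat (transpose_mat (U' i) * M i))
                     (r' i * n (i + 1)) ((\<Prod>j=i+2..d. n j) * b)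
              else transpose_mat (U' d) * M d)"
    and Ulast: "U' (d + 1) = append_cols (P (d + 1)) (M (d + 1))"
    unfolding tt_ice_def by blast
  have U: "U i \<in> carrier_mat (r (i - 1) * n i) (r i)" "orthonormal_cols (U i)" if "i \<in> {1..d}" for i
    using assms(2) that by (auto simp: unfolded_tt_cores_def)
  have Ud: "U (d + 1) \<in> carrier_mat (r d) (\<Sum>l=1..k. batch l)" and r0: "r 0 = 1"
    using assms(2) by (auto simp: unfolded_tt_cores_def)

  (* The matrices of a run fit together, and each step meets the conditions of extended_basis. *)
  have M: "M i \<in> carrier_mat (r' (i - 1) * n i) (Q (Suc i))" if "i \<in> {1..d}" for i
  proof (cases "i = 1")
    case True
    then show ?thesis
      using M1 r'0 by (simp add: Q_def numeral_2_eq_2)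
  next
    case False
    with that have "i - 1 \<in> {1..d}" "i - 1 < d" "i - 1 + 1 = i" "i - 1 + 2 = Suc i" by auto
    with alg_step[of "i - 1"] show ?thesis by (simp add: Q_def)
  qed
  have P: "P i \<in> carrier_mat (r' (i - 1) * n i) (r i) \<and> orthonormal_cols (P i)" if "i \<in> {1..d}" for i
  proof (cases "i = 1")
    case True
    then show ?thesis using U[OF that] P1 r0 r'0 by simp
  next
    case False
    with that have i: "i - 1 \<in> {1..d}" "i - 1 < d" "i - 1 + 1 = i" by auto
    with alg_step[of "i - 1"] U[OF that] show ?thesis
      by (simp add: orthonormal_padded_core)
  qed
  have U': "U' i \<in> carrier_mat (r' (i - 1) * n i) (r' i)" "orthonormal_cols (U' i)"
    "mat_frob (M i - U' i * (transpose_mat (U' i) * M i)) \<le> \<epsilon> i" if "i \<in> {1..d}" for i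
  proof -
    from alg_step[OF that] have s: "R i = (1\<^sub>m (r' (i - 1) * n i) - P i * transpose_mat (P i)) * M i"
      "is_truncated_svd (R i) (\<epsilon> i) (U\<^sub>R i) (V\<^sub>R i) (E i) (r\<^sub>R i)"
      "U' i = append_cols (P i) (U\<^sub>R i)" "r' i = r i + r\<^sub>R i" by blast+
    have "0 \<le> \<epsilon> i" using assms(4) that by blast
    from extended_basis[OF conjunct1[OF P[OF that]] conjunct2[OF P[OF that]] M[OF that] s(1,2) this]
    show "U' i \<in> carrier_mat (r' (i - 1) * n i) (r' i)" "orthonormal_cols (U' i)"
      "mat_frob (M i - U' i * (transpose_mat (U' i) * M i)) \<le> \<epsilon> i"
      by (simp_all only: s(3,4))
  qed

  (* The last columns of the final core are the coefficients M (d + 1) computed in step d. *)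
  define L where "L = last_cols b (U' (Suc d))"
  have dd: "d \<in> {1..d}" using assms(1) by simp
  have d_step: "r' d = r d + r\<^sub>R d" "P (Suc d) = append_zero_rows (r\<^sub>R d) (U (d + 1))"
    "M (Suc d) = transpose_mat (U' d) * M d"
    using alg_step[OF dd] by simp_all
  have "transpose_mat (U' d) \<in> carrier_mat (r' d) (r' (d - 1) * n d)" using U'(1)[OF dd] by simp
  from mult_carrier_mat[OF this M[OF dd]] have M_last: "M (Suc d) \<in> carrier_mat (r' d) b"
    by (simp add: d_step(3) Q_def)
  have "dim_row (P (Suc d)) = r' d"
    using Ud by (simp add: d_step append_zero_rows_def append_rows_def)
  then have LM: "L = M (Suc d)"
    using last_cols_append_cols[of "M (Suc d)" "P (Suc d)"] M_last Ulast by (simp add: L_def)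
  have L: "L \<in> carrier_mat (r' d) b" using M_last LM by simp
  interpret tt: tt_cores d b n r' U' L
    using U'(1) L by unfold_locales
  have modes: "prod_list (tt.modes i) = Q i" for i
    by (simp add: tt.prod_list_modes Q_def)
  have Z: "tt.tail i \<in> carrier_mat (r' (i - 1)) (Q i)" if "i \<le> Suc d" for i
    using tt.tail_carrier[OF that] by (simp add: modes)
  have W: "U' i * tt.tail (Suc i) \<in> carrier_mat (r' (i - 1) * n i) (Q (Suc i))" if "i \<in> {1..d}" for i
    using U'(1)[OF that] Z[of "Suc i"] that by (intro mult_carrier_mat) auto
  have Q: "Q i = n i * Q (Suc i)" if "i \<in> {1..d}" for i
    using that by (simp add: Q_def prod.atLeast_Suc_atMost)

  (* U' i * tail (i + 1) has the shape of M i, tail i that of the coefficients from step i - 1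
     or, for i = 1, that of the whole tensor as a single row. *)
  have refold_W: "reshape_mat (tensor_of_mat (U' i * tt.tail (Suc i))) (r' (i - 1)) (Q i) = tt.tail i"
    if "i \<in> {1..d}" for i
    using tt.tail_step[of i] that by (simp add: modes)

  have bound: "(mat_frob (M i - U' i * tt.tail (Suc i)))\<^sup>2 \<le> (\<Sum>j=i..d. (\<epsilon> j)\<^sup>2)" if "i \<in> {1..d}" for i
  proof -
    from that have "i \<le> d" "1 \<le> i" by auto
    then show ?thesis
    proof (induction i rule: inc_induct)
      case base
      have "transpose_mat (U' d) * M d = tt.tail (Suc d)"
        unfolding d_step(3)[symmetric] LM[symmetric] tt.tail_last ..
      then show ?case
        using U'(3)[OF dd] mat_frob_nonneg by (simp add: power_mono)
    next
      case (step i)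
      then have i: "i \<in> {1..d}" "Suc i \<in> {1..d}" "i < d" by auto
      have T: "transpose_mat (U' i) * M i \<in> carrier_mat (r' i) (Q (Suc i))"
        using U'(1)[OF i(1)] M[OF i(1)] by simp
      have ZS: "tt.tail (Suc i) \<in> carrier_mat (r' i) (Q (Suc i))" using Z[of "Suc i"] i by simp
      have MS: "M (Suc i) = reshape_mat (tensor_of_mat (transpose_mat (U' i) * M i))
          (r' i * n (Suc i)) (Q (Suc (Suc i)))"
        using alg_step[OF i(1)] i(3) by (simp add: Q_def)
      have W': "U' (Suc i) * tt.tail (Suc (Suc i)) \<in> carrier_mat (r' i * n (Suc i)) (Q (Suc (Suc i)))"
        using W[OF i(2)] by simp
      have size: "r' i * n (Suc i) * Q (Suc (Suc i)) = r' i * Q (Suc i)"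
        by (simp only: Q[OF i(2)] mult.assoc)
      have "tt.tail (Suc i) = reshape_mat (tensor_of_mat (U' (Suc i) * tt.tail (Suc (Suc i))))
          (r' i) (Q (Suc i))"
        using refold_W[OF i(2)] by simp
      then have WS: "U' (Suc i) * tt.tail (Suc (Suc i)) =
          reshape_mat (tensor_of_mat (tt.tail (Suc i))) (r' i * n (Suc i)) (Q (Suc (Suc i)))"
        using reshape_mat_tensor_of_mat[of "U' (Suc i) * tt.tail (Suc (Suc i))"]
        by (simp only: reshape_mat_reshape_mat[OF size[symmetric]] carrier_matD[OF W'])
      (* The coefficient error of step i, reshaped, is the approximation error of step i + 1. *)
      have "mat_frob (transpose_mat (U' i) * M i - tt.tail (Suc i)) =
          mat_frob (M (Suc i) - U' (Suc i) * tt.tail (Suc (Suc i)))"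
        unfolding MS WS reshape_mat_diff[OF T ZS size, symmetric]
        using T ZS size by (subst mat_frob_reshape_mat) auto
      then have "(mat_frob (M i - U' i * tt.tail (Suc i)))\<^sup>2 =
          (mat_frob (M i - U' i * (transpose_mat (U' i) * M i)))\<^sup>2 +
          (mat_frob (M (Suc i) - U' (Suc i) * tt.tail (Suc (Suc i))))\<^sup>2"
        by (simp only: mat_frob_orthonormal_fit[OF U'(2,1)[OF i(1)] M[OF i(1)] ZS])
      also have "\<dots> \<le> (\<epsilon> i)\<^sup>2 + (\<Sum>j=Suc i..d. (\<epsilon> j)\<^sup>2)"
        using step.IH U'(3)[OF i(1)] by (intro add_mono power_mono) (simp_all add: mat_frob_nonneg)
      also have "\<dots> = (\<Sum>j=i..d. (\<epsilon> j)\<^sup>2)"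
        using i(3) by (simp add: sum.atLeast_Suc_atMost)
      finally show ?case .
    qed
  qed

  let ?ds = "tt.modes 1"
  have one: "1 \<in> {1..d}" using assms(1) by simp
  have dimsY: "dims Y = ?ds" using assms(3)[folded b_def] by (simp only: tt.modes_def Suc_eq_plus1)
  have Q1: "1 * Q 1 = n 1 * Q (Suc 1)" by (simp only: Q[OF one] mult_1)
  have Y1: "reshape_mat Y 1 (Q 1) = reshape_mat (tensor_of_mat (M 1)) 1 (Q 1)"
  proof -
    have "M 1 = reshape_mat Y (n 1) (Q (Suc 1))"
      unfolding M1 by (simp add: Q_def numeral_2_eq_2)
    then show ?thesis by (simp only: reshape_mat_reshape_mat[OF Q1[symmetric]])
  qed
  (* The error of the tensor, unfolded to a single row and then to the shape of M 1. *)
  have "(tensor_frob (tensor_minus Y (tt_last_batch d n b r' U')))\<^sup>2 =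
      (\<Sum>is\<in>indices ?ds. (entry Y is - tt.tail 1 $$ (0, lin_index ?ds is))\<^sup>2)"
    using tt.entry_tt_last_batch[OF assms(1) r'0] L_def
    by (simp add: tensor_frob_def tensor_minus_def dimsY sum_nonneg)
  also have "\<dots> = (\<Sum>c<Q 1. (reshape_mat Y 1 (Q 1) $$ (0, c) - tt.tail 1 $$ (0, c))\<^sup>2)"
    unfolding sum_indices modes
    by (intro sum.cong refl) (simp add: lin_index_multi_index index_reshape_mat dimsY modes)
  also have "\<dots> = (mat_frob (reshape_mat Y 1 (Q 1) - tt.tail 1))\<^sup>2"
    using Z[of 1] r'0 by (simp add: mat_frob_sq)
  also have "mat_frob (reshape_mat Y 1 (Q 1) - tt.tail 1) = mat_frob (M 1 - U' 1 * tt.tail (Suc 1))"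
  proof -
    have c: "M 1 \<in> carrier_mat (n 1) (Q (Suc 1))" "U' 1 * tt.tail (Suc 1) \<in> carrier_mat (n 1) (Q (Suc 1))"
      using M[OF one] W[OF one] r'0 by simp_all
    have "tt.tail 1 = reshape_mat (tensor_of_mat (U' 1 * tt.tail (Suc 1))) 1 (Q 1)"
      using refold_W[OF one] r'0 by simp
    then have "reshape_mat Y 1 (Q 1) - tt.tail 1 =
        reshape_mat (tensor_of_mat (M 1 - U' 1 * tt.tail (Suc 1))) 1 (Q 1)"
      unfolding Y1 by (simp only: reshape_mat_diff[OF c Q1])
    then show ?thesis
      by (simp only: mat_frob_reshape_mat carrier_matD[OF minus_carrier_mat[OF c(2)]] Q1)
  qed
  also have "(mat_frob (M 1 - U' 1 * tt.tail (Suc 1)))\<^sup>2 \<le> (\<Sum>i=1..d. (\<epsilon> i)\<^sup>2)"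
    using bound[OF one] .
  finally show ?thesis unfolding b_def by (rule real_le_rsqrt)
qed

end
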